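(* Let $(N,V)$ be the cooperative game associated with a fractional linear production problem, and let $D(N)$ be the dual linear problem, both as defined in the context. Let $\omega^*=(\omega^*_1,\dots,\omega^*_{m+1})^T$ be an optimal solution of $D(N)$, and let $u=(u_1,\dots,u_n)^T$ with $u_i=\frac1n\omega_1^*$ for each $i\in\{1,\dots,n\}$. Then $u$ belongs to the core of $(N,V)$, i.e. $\sum_{i\in N}u_i=V(N)$ and $\sum_{i\in S}u_i\ge V(S)$ for every nonempty $S\subseteq N$.
   Context: Let $N=\{1,\dots,n\}$ be the set of players; coalitions are nonempty subsets of $N$. There are $m$ resources and $p$ goods. Player $i$ owns a resource vector $b^i=(b^i_1,\dots,b^i_m)\in\mathbb{R}^m$ with $b^i_k\ge 0$; for a coalition $S$ put $b(S)=\sum_{i\in S}b^i\in\mathbb{R}^m$. Let $A=(a_{kj})\in\mathbb{R}^{m\times p}$, $c,d\in\mathbb{R}^p$, $c_0,d_0\in\mathbb{R}$. Coalition $S$ wants to maximize $\frac{c\cdot x+c_0}{d\cdot x+d_0}$ over $D_S=\{x\in\mathbb{R}^p: Ax\le b(S),\ x\ge 0\}$; it is assumed that $d\cdot x+d_0>0$ for every $x\in D_S$ and every coalition $S$. After the Charnes–Cooper substitution $y=tx$, $t=1/(d\cdot x+d_0)$, one considers, for each coalition $S$, the linear problem $P(S)$: maximize $c\cdot y+c_0t$ over $(y,t)\in\mathbb{R}^p\times\mathbb{R}$ subject to $d\cdot y+d_0t\le 1$, $Ay-t\,b(S)\le 0$, $t>0$, $y\ge 0$. It is assumed that each $P(S)$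 has an optimal solution. A collection $\mathcal{B}$ of coalitions is balanced if there are weights $\gamma(S)>0$, $S\in\mathcal{B}$, such that $\sum_{S\in\mathcal{B},\,i\in S}\gamma(S)=1$ for each $i\in N$. Let $\gamma^*$ be the maximum of $\sum_{S\in\mathcal{B}}\gamma(S)$ over all balanced collections $\mathcal{B}$ (and their balancing weights), and fix a real number $\gamma>\max(\gamma^*,n)$. The game $(N,V)$ is defined by: $V(S)$ is the optimal value of $P(S)$ for every nonempty $S\subsetneq N$, and $V(N)$ is $\gamma$ times the optimal value of $P(N)$. The dual problem is $D(N)$: minimize $\omega_1$ over $\omega\in\mathbb{R}^{m+1}$ subject to $\omega_1 d+A^T(\omega_2,\dots,\omega_{m+1})^T\ge\gamma c$, $\ d_0\omega_1-b(N)\cdot(\omega_2,\dots,\omega_{m+1})\ge\gamma c_0$, $\ \omega_i\ge 0$ for $i=1,\dots,m+1$. *)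

theory Defs
  imports "HOL-Analysis.Analysis"
begin

(* The players are the elements of the finite type 'n, so N = UNIV and n = CARD('n);
   resources are indexed by 'm and goods by 'p. Orders on vectors are componentwise,
   and b(S) is written sum b S. *)

definition production_set ::
  "real^'p^'m \<Rightarrow> ('n \<Rightarrow> real^'m) \<Rightarrow> 'n set \<Rightarrow> (real^'p) set" where
  "production_set A b S = {x. A *v x \<le> sum b S \<and> 0 \<le> x}"

definition primal_feasible ::
  "real^'p^'m \<Rightarrow> ('n \<Rightarrow> real^'m) \<Rightarrow> real^'p \<Rightarrow> real \<Rightarrow> 'n set \<Rightarrow> ((real^'p) \<times> real) set" where
  "primal_feasible A b d d0 S =
     {(y, t). d \<bullet> y + d0 * t \<le> 1 \<and> A *v y - t *\<^sub>R sum b S \<le> 0 \<and> t > 0 \<and> 0 \<le> y}"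

definition primal_objective :: "real^'p \<Rightarrow> real \<Rightarrow> (real^'p) \<times> real \<Rightarrow> real" where
  "primal_objective c c0 = (\<lambda>(y, t). c \<bullet> y + c0 * t)"

definition primal_optimal ::
  "real^'p^'m \<Rightarrow> ('n \<Rightarrow> real^'m) \<Rightarrow> real^'p \<Rightarrow> real \<Rightarrow> real^'p \<Rightarrow> real \<Rightarrow> 'n set
     \<Rightarrow> (real^'p) \<times> real \<Rightarrow> bool" where
  "primal_optimal A b c c0 d d0 S z \<longleftrightarrow>
     z \<in> primal_feasible A b d d0 S \<and>
     (\<forall>z' \<in> primal_feasible A b d d0 S. primal_objective c c0 z' \<le> primal_objective c c0 z)"

definition primal_value ::
  "real^'p^'m \<Rightarrow> ('n \<Rightarrow> real^'m) \<Rightarrow> real^'p \<Rightarrow> real \<Rightarrow> real^'p \<Rightarrow> real \<Rightarrow> 'n set \<Rightarrow> real" where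
  "primal_value A b c c0 d d0 S =
     (SUP z \<in> primal_feasible A b d d0 S. primal_objective c c0 z)"

lemma primal_value_eq:
  assumes "primal_optimal A b c c0 d d0 S z"
  shows "primal_value A b c c0 d d0 S = primal_objective c c0 z"
  using assms unfolding primal_value_def primal_optimal_def
  by (intro cSup_eq_maximum) auto

definition balancing_weights :: "'n set \<Rightarrow> 'n set set \<Rightarrow> ('n set \<Rightarrow> real) \<Rightarrow> bool" where
  "balancing_weights N B g \<longleftrightarrow>
     B \<subseteq> Pow N - {{}} \<and> (\<forall>S\<in>B. g S > 0) \<and> (\<forall>i\<in>N. (\<Sum>S \<in> {S \<in> B. i \<in> S}. g S) = 1)"

definition max_balancing_total :: "'n set \<Rightarrow> real" where
  "max_balancing_total N = (GREATEST r. \<exists>B g. balancing_weights N B g \<and> r = (\<Sum>S\<in>B. g S))"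

(* The maximum is attained, by the singletons with unit weights. *)
lemma max_balancing_total_eq_card:
  assumes "finite N"
  shows "max_balancing_total N = card N"
  unfolding max_balancing_total_def
proof (rule Greatest_equality)
  let ?B = "(\<lambda>i. {i}) ` N"
  have "{S \<in> ?B. i \<in> S} = {{i}}" if "i \<in> N" for i
    using that by auto
  then have "balancing_weights N ?B (\<lambda>_. 1)"
    unfolding balancing_weights_def by auto
  moreover have "(\<Sum>S\<in>?B. 1::real) = card N"
    by (simp add: card_image)
  ultimately show "\<exists>B g. balancing_weights N B g \<and> real (card N) = (\<Sum>S\<in>B. g S)"
    by metis
next
  fix r assume "\<exists>B g. balancing_weights N B g \<and> r = (\<Sum>S\<in>B. g S)"
  then obtain B g where B: "B \<subseteq> Pow N - {{}}" and pos: "\<And>S. S \<in> B \<Longrightarrow> g S > 0"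
    and one: "\<And>i. i \<in> N \<Longrightarrow> (\<Sum>S \<in> {S \<in> B. i \<in> S}. g S) = 1" and r: "r = (\<Sum>S\<in>B. g S)"
    unfolding balancing_weights_def by blast
  have finB: "finite B"
    using B assms by (meson Diff_subset finite_Pow_iff finite_subset)
  have "g S \<le> (\<Sum>i\<in>{i \<in> N. i \<in> S}. g S)" if "S \<in> B" for S
  proof -
    have "{i \<in> N. i \<in> S} \<noteq> {}" using B that by auto
    then have "card {i \<in> N. i \<in> S} \<ge> 1"
      using assms by (simp add: Suc_leI card_gt_0_iff)
    then show ?thesis
      using pos[OF that] by simp
  qed
  then have "r \<le> (\<Sum>S\<in>B. \<Sum>i\<in>{i \<in> N. i \<in> S}. g S)"
    unfolding r by (rule sum_mono)
  also have "\<dots> = (\<Sum>i\<in>N. \<Sum>S\<in>{S \<in> B. i \<in> S}. g S)"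
    by (rule sum.swap_restrict[OF finB assms])
  also have "\<dots> = card N"
    using one by simp
  finally show "r \<le> card N" .
qed

(* The value at the empty set carries no meaning: only coalitions are considered. *)
definition production_game ::
  "real^'p^'m \<Rightarrow> ('n \<Rightarrow> real^'m) \<Rightarrow> real^'p \<Rightarrow> real \<Rightarrow> real^'p \<Rightarrow> real \<Rightarrow> real
     \<Rightarrow> 'n set \<Rightarrow> real" where
  "production_game A b c c0 d d0 \<gamma> S =
     (if S = UNIV then \<gamma> * primal_value A b c c0 d d0 UNIV else primal_value A b c c0 d d0 S)"

(* A vector of R^(m+1) is a pair: its first coordinate and the remaining m ones. *)
definition dual_feasible ::
  "real^'p^'m \<Rightarrow> ('n \<Rightarrow> real^'m) \<Rightarrow> real^'p \<Rightarrow> real \<Rightarrow> real^'p \<Rightarrow> real \<Rightarrow> real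
     \<Rightarrow> (real \<times> (real^'m)) set" where
  "dual_feasible A b c c0 d d0 \<gamma> =
     {(w1, w). \<gamma> *\<^sub>R c \<le> w1 *\<^sub>R d + transpose A *v w \<and>
               \<gamma> * c0 \<le> d0 * w1 - sum b UNIV \<bullet> w \<and> 0 \<le> w1 \<and> 0 \<le> w}"

definition dual_optimal ::
  "real^'p^'m \<Rightarrow> ('n \<Rightarrow> real^'m) \<Rightarrow> real^'p \<Rightarrow> real \<Rightarrow> real^'p \<Rightarrow> real \<Rightarrow> real
     \<Rightarrow> real \<times> (real^'m) \<Rightarrow> bool" where
  "dual_optimal A b c c0 d d0 \<gamma> \<omega> \<longleftrightarrow>
     \<omega> \<in> dual_feasible A b c c0 d d0 \<gamma> \<and>
     (\<forall>\<omega>' \<in> dual_feasible A b c c0 d d0 \<gamma>. fst \<omega> \<le> fst \<omega>')"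

definition core :: "('n::finite set \<Rightarrow> real) \<Rightarrow> (real^'n) set" where
  "core V = {u. (\<Sum>i\<in>UNIV. u $ i) = V UNIV \<and> (\<forall>S. S \<noteq> {} \<longrightarrow> V S \<le> (\<Sum>i\<in>S. u $ i))}"

end

theory Submission imports Defs begin

text \<open>By linear programming duality \<open>\<omega>\<^sub>1\<close> equals \<open>\<gamma>\<close> times the optimal value of \<open>P(N)\<close>. That value
  is nonnegative because \<open>\<omega>\<^sub>1 \<ge> 0\<close>, and it dominates the value of every \<open>P(S)\<close> because \<open>b(S) \<le> b(N)\<close>;
  since \<open>\<gamma> > n\<close>, even one share \<open>\<omega>\<^sub>1 / n\<close> is at least the value of any \<open>P(S)\<close>.

  Strong duality must cope with the strict constraint \<open>t > 0\<close>. The separation argument produces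
  a point with \<open>t \<ge> 0\<close> only, which is then added to an optimal solution of \<open>P(N)\<close>.\<close>

text \<open>Farkas' lemma: a finitely generated convex cone is closed, so a hyperplane strictly
  separates \<open>z\<close> from it, and scaling inside the cone lets the hyperplane be moved to
  the origin.\<close>

lemma finitely_generated_cone_separation:
  fixes F :: "'a::euclidean_space set"
  assumes "finite F" and z: "z \<notin> convex_cone hull F"
  obtains a where "a \<bullet> z > 0" and "\<And>x. x \<in> F \<Longrightarrow> a \<bullet> x \<le> 0"
proof -
  let ?K = "convex_cone hull F"
  obtain a \<beta> where az: "a \<bullet> z < \<beta>" and aK: "\<And>x. x \<in> ?K \<Longrightarrow> \<beta> < a \<bullet> x"
    using separating_hyperplane_closed_point[OF convex_convex_cone_hull
        closed_convex_cone_hull[OF \<open>finite F\<close>] z] by blast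
  have \<beta>: "\<beta> < 0"
    using aK[OF convex_cone_hull_contains_0] by simp
  have "a \<bullet> x \<ge> 0" if "x \<in> F" for x
  proof (rule ccontr)
    assume neg: "\<not> a \<bullet> x \<ge> 0"
    \<comment> \<open>The factor is positive, both numbers being negative, and it is chosen so that
      the scaled point has inner product exactly \<beta> with \<open>a\<close>, which the strict
      bound \<open>aK\<close> forbids.\<close>
    then have "(\<beta> / (a \<bullet> x)) *\<^sub>R x \<in> ?K"
      using \<beta> that by (intro convex_cone_hull_mul hull_inc) (auto simp: divide_nonpos_nonpos)
    from aK[OF this] neg show False by simp
  qed
  then show ?thesis
    using az \<beta> by (intro that[of "- a"]) auto
qed

lemma inner_nonneg_vec:
  fixes x y :: "real^'n"
  assumes "0 \<le> x" "0 \<le> y"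
  shows "0 \<le> x \<bullet> y"
  using assms by (auto simp: inner_vec_def less_eq_vec_def intro!: sum_nonneg)

text \<open>Each constraint is paired with the nonnegative variable dual to it: the columns with
  \<open>y\<close>, the \<open>c0\<close> inequality with \<open>t\<close>, the resources with
  \<open>w\<close>, the normalisation with \<open>w1\<close>. In the sum the mixed terms
  cancel.\<close>

lemma weak_duality:
  assumes primal: "z \<in> primal_feasible A b d d0 UNIV"
    and dual: "\<omega> \<in> dual_feasible A b c c0 d d0 \<gamma>"
  shows "\<gamma> * primal_objective c c0 z \<le> fst \<omega>"
proof -
  obtain y t where z: "z = (y, t)" by fastforce
  obtain w1 w where \<omega>: "\<omega> = (w1, w)" by fastforce
  let ?\<beta> = "sum b UNIV"
  have y: "0 \<le> y" and t: "t > 0" and den: "d \<bullet> y + d0 * t \<le> 1"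
    and res: "0 \<le> t *\<^sub>R ?\<beta> - A *v y"
    using primal unfolding z primal_feasible_def by (auto simp: algebra_simps)
  have w1: "0 \<le> w1" and w: "0 \<le> w" and col: "0 \<le> w1 *\<^sub>R d + transpose A *v w - \<gamma> *\<^sub>R c"
    and shift: "\<gamma> * c0 \<le> d0 * w1 - ?\<beta> \<bullet> w"
    using dual unfolding \<omega> dual_feasible_def by auto
  have "\<gamma> * (c \<bullet> y) \<le> w1 * (d \<bullet> y) + w \<bullet> (A *v y)"
    using inner_nonneg_vec[OF col y]
    by (simp add: inner_diff_left inner_add_left dot_lmul_matrix)
  moreover have "\<gamma> * c0 * t \<le> (d0 * w1 - ?\<beta> \<bullet> w) * t"
    using shift t by (intro mult_right_mono) auto
  moreover have "w \<bullet> (A *v y) \<le> t * (?\<beta> \<bullet> w)"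
    using inner_nonneg_vec[OF w res] by (simp add: inner_diff_right inner_commute)
  moreover have "w1 * (d \<bullet> y + d0 * t) \<le> w1"
    using mult_left_mono[OF den w1] by simp
  ultimately show ?thesis
    unfolding z \<omega> primal_objective_def by (simp add: algebra_simps)
qed

text \<open>A certificate for \<gamma> = 1 is found first and scaled at the end. If none existed, a
  vector separating \<open>(c, c0, ?v)\<close> from the cone of dual constraints would yield a
  feasible point of P(N) better than \<open>z\<close>.\<close>

lemma strong_duality:
  fixes A :: "real^'p^'m" and b :: "'n::finite \<Rightarrow> real^'m"
  assumes opt: "primal_optimal A b c c0 d d0 UNIV z" and \<gamma>: "\<gamma> \<ge> 0"
  obtains \<omega> where "\<omega> \<in> dual_feasible A b c c0 d d0 \<gamma>"
    and "fst \<omega> \<le> \<gamma> * primal_objective c c0 z"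
proof -
  let ?\<beta> = "sum b UNIV" and ?v = "primal_objective c c0 z"
  \<comment> \<open>\<open>(c, c\<^sub>0, q)\<close> lies in \<open>?T\<close> iff the dual problem for \<open>\<gamma> = 1\<close> has a feasible point of value at most \<open>q\<close>.\<close>
  let ?T = "{(x, s, q) |x s q. \<exists>w1 w. 0 \<le> w1 \<and> 0 \<le> w \<and> x \<le> w1 *\<^sub>R d + transpose A *v w \<and>
               s \<le> d0 * w1 - ?\<beta> \<bullet> w \<and> w1 \<le> q} :: ((real^'p) \<times> real \<times> real) set"
  let ?R = "range (\<lambda>k. (A $ k, - (?\<beta> $ k), 0)) :: ((real^'p) \<times> real \<times> real) set"
  let ?E = "range (\<lambda>j. (- axis j 1, 0, 0)) :: ((real^'p) \<times> real \<times> real) set"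
  \<comment> \<open>\<open>(d, d0, 1)\<close> is the column of \<open>w1\<close> and
    \<open>?R\<close> holds the columns of the entries of \<open>w\<close>; the other generators are
    the slacks of the inequalities defining \<open>?T\<close>.\<close>
  let ?F = "{(d, d0, 1), (0, - 1, 0), (0, 0, 1)} \<union> ?R \<union> ?E"
  have "(c, c0, ?v) \<in> convex_cone hull ?F"
  proof (rule ccontr)
    assume "(c, c0, ?v) \<notin> convex_cone hull ?F"
    moreover have "finite ?F" by simp
    ultimately obtain a where pos: "a \<bullet> (c, c0, ?v) > 0" and neg: "\<And>x. x \<in> ?F \<Longrightarrow> a \<bullet> x \<le> 0"
      using finitely_generated_cone_separation by blast
    \<comment> \<open>With this sign, the inequalities on the generators say that
      \<open>(y, t)\<close> satisfies the constraints of P(N) with the bound 1 replaced by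
      \<open>r\<close> and \<open>t > 0\<close> weakened.\<close>
    obtain y t r where a: "a = (y, t, - r)"
      by (metis prod_cases3 minus_minus)
    have t: "t \<ge> 0" and r: "r \<ge> 0" and den: "d \<bullet> y + d0 * t \<le> r"
      using neg[of "(0, -1, 0)"] neg[of "(0, 0, 1)"] neg[of "(d, d0, 1)"]
      by (auto simp: a inner_commute mult.commute)
    have y: "0 \<le> y"
      unfolding less_eq_vec_def
    proof
      fix j show "0 $ j \<le> y $ j"
        using neg[of "(- axis j 1, 0, 0)"] by (simp add: a inner_axis)
    qed
    have res: "(A *v y) $ k \<le> t * ?\<beta> $ k" for k
      using neg[of "(A $ k, - (?\<beta> $ k), 0)"]
      by (simp add: a matrix_vector_mul_component inner_commute)
    have val: "c \<bullet> y + c0 * t > ?v * r"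
      using pos by (simp add: a inner_commute mult.commute)
    obtain y' t' where z: "z = (y', t')" by fastforce
    have y': "0 \<le> y'" and t': "t' > 0" and den': "d \<bullet> y' + d0 * t' \<le> 1"
      and res': "A *v y' - t' *\<^sub>R ?\<beta> \<le> 0"
      using opt unfolding primal_optimal_def z primal_feasible_def by auto
    \<comment> \<open>The sum of \<open>(y', t')\<close> and \<open>(y, t)\<close> meets the
      normalisation with bound \<open>1 + r\<close>, hence this rescaling; \<open>t' > 0\<close>
      makes the last coordinate strictly positive even if \<open>t = 0\<close>.\<close>
    let ?s = "1 / (1 + r)"
    let ?z = "(?s *\<^sub>R (y' + y), ?s * (t' + t))"
    have "d \<bullet> (?s *\<^sub>R (y' + y)) + d0 * (?s * (t' + t)) = ?s * (d \<bullet> y' + d0 * t' + (d \<bullet> y + d0 * t))"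
      by (simp add: inner_add_right algebra_simps add_divide_distrib)
    also have "\<dots> \<le> ?s * (1 + r)"
      using den den' r by (intro mult_left_mono) auto
    finally have "d \<bullet> (?s *\<^sub>R (y' + y)) + d0 * (?s * (t' + t)) \<le> 1"
      using r by simp
    moreover have "A *v (?s *\<^sub>R (y' + y)) - (?s * (t' + t)) *\<^sub>R ?\<beta> \<le> 0"
      unfolding less_eq_vec_def
    proof
      fix k
      have "(A *v y') $ k \<le> t' * ?\<beta> $ k"
        using res' by (auto simp: less_eq_vec_def)
      then have "?s * ((A *v y') $ k + (A *v y) $ k) \<le> ?s * (t' * ?\<beta> $ k + t * ?\<beta> $ k)"
        using res[of k] r by (intro mult_left_mono add_mono) auto
      then show "(A *v (?s *\<^sub>R (y' + y)) - (?s * (t' + t)) *\<^sub>R ?\<beta>) $ k \<le> 0 $ k"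
        by (simp add: matrix_vector_mult_scaleR matrix_vector_right_distrib algebra_simps add_divide_distrib
            del: sum_component)
    qed
    moreover have "?s * (t' + t) > 0"
      using r t t' by simp
    moreover have "0 \<le> ?s *\<^sub>R (y' + y)"
      using r y y' by (auto simp: less_eq_vec_def)
    ultimately have "?z \<in> primal_feasible A b d d0 UNIV"
      unfolding primal_feasible_def by simp
    then have "primal_objective c c0 ?z \<le> ?v"
      using opt unfolding primal_optimal_def by blast
    moreover have "primal_objective c c0 ?z = ?s * (?v + (c \<bullet> y + c0 * t))"
      unfolding primal_objective_def z by (simp add: inner_add_right algebra_simps add_divide_distrib)
    \<comment> \<open>By \<open>val\<close>, the added direction gains more than
      \<open>?v * r\<close>, so after rescaling the objective strictly exceeds the optimum
      \<open>?v\<close>.\<close>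
    moreover have "?s * (?v + (c \<bullet> y + c0 * t)) > ?s * (?v + ?v * r)"
      using val r by (intro mult_strict_left_mono) auto
    moreover have "?s * (?v + ?v * r) = ?v"
      using r by (simp add: field_simps)
    ultimately show False by linarith
  qed
  also have "convex_cone hull ?F \<subseteq> ?T"
  proof (rule hull_minimal)
    have "(d, d0, 1) \<in> ?T"
      by (auto intro!: exI[of _ "1::real"] exI[of _ "0::real^'m"])
    moreover have "(0, - 1, 0) \<in> ?T" "(0, 0, 1) \<in> ?T"
      by (auto intro!: exI[of _ 0])
    moreover have "(- axis j 1, 0, 0) \<in> ?T" for j
      by (auto simp: less_eq_vec_def axis_def intro!: exI[of _ 0])
    moreover have "(A $ k, - (?\<beta> $ k), 0) \<in> ?T" for k
    proof -
      \<comment> \<open>The dual witness for a resource generator is \<open>w1 = 0\<close> with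
        \<open>w\<close> the \<open>k\<close>-th unit vector.\<close>
      have "A $ k = transpose A *v axis k 1"
        by (simp add: vec_eq_iff matrix_vector_mult_def transpose_def axis_def if_distrib cong: if_cong)
      moreover have "(0 :: real^'m) \<le> axis k 1"
        by (auto simp: less_eq_vec_def axis_def)
      ultimately show ?thesis
        by (auto simp: inner_axis intro!: exI[of _ "0::real"] exI[of _ "axis k 1"])
    qed
    ultimately show "?F \<subseteq> ?T" by blast
  next
    show "convex_cone ?T"
      unfolding convex_cone_iff
    proof (intro conjI ballI allI impI)
      show "0 \<in> ?T"
        by (auto simp: zero_prod_def intro!: exI[of _ 0])
    next
      fix x y assume "x \<in> ?T" "y \<in> ?T"
      then obtain x1 s q w1 w x1' s' q' w1' w'
        where x: "x = (x1, s, q)" and y: "y = (x1', s', q')"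
          and "0 \<le> w1" "0 \<le> w" and s: "s \<le> d0 * w1 - ?\<beta> \<bullet> w" and "w1 \<le> q"
          and "0 \<le> w1'" "0 \<le> w'" and s': "s' \<le> d0 * w1' - ?\<beta> \<bullet> w'" and "w1' \<le> q'"
          and x1: "x1 \<le> w1 *\<^sub>R d + transpose A *v w" and x1': "x1' \<le> w1' *\<^sub>R d + transpose A *v w'"
        by blast
      moreover have "x1 + x1' \<le> (w1 + w1') *\<^sub>R d + transpose A *v (w + w')"
        using add_mono[OF x1 x1'] by (simp only: matrix_vector_right_distrib scaleR_left_distrib ac_simps)
      moreover have "s + s' \<le> d0 * (w1 + w1') - ?\<beta> \<bullet> (w + w')"
        using s s' by (simp add: inner_add_right distrib_left)
      ultimately show "x + y \<in> ?T"
        by (auto simp del: transpose_matrix_vector intro!: exI[of _ "w1 + w1'"] exI[of _ "w + w'"])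
    next
      fix x and e :: real assume "x \<in> ?T" and e: "0 \<le> e"
      then obtain x1 s q w1 w
        where x: "x = (x1, s, q)" and "0 \<le> w1" "0 \<le> w" "w1 \<le> q"
          and s: "s \<le> d0 * w1 - ?\<beta> \<bullet> w" and x1: "x1 \<le> w1 *\<^sub>R d + transpose A *v w"
        by blast
      moreover have "e *\<^sub>R x1 \<le> (e * w1) *\<^sub>R d + transpose A *v (e *\<^sub>R w)"
        using scaleR_left_mono[OF x1 e]
        by (simp add: matrix_vector_mult_scaleR scaleR_right_distrib del: transpose_matrix_vector)
      moreover have "e * s \<le> d0 * (e * w1) - ?\<beta> \<bullet> (e *\<^sub>R w)"
        using mult_left_mono[OF s e] by (simp add: algebra_simps)
      ultimately show "e *\<^sub>R x \<in> ?T"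
        using e by (auto simp del: transpose_matrix_vector
            intro!: exI[of _ "e * w1"] exI[of _ "e *\<^sub>R w"] mult_left_mono scaleR_nonneg_nonneg)
    qed
  qed
  finally obtain w1 w where w: "0 \<le> w1" "0 \<le> w" and col: "c \<le> w1 *\<^sub>R d + transpose A *v w"
    and shift: "c0 \<le> d0 * w1 - ?\<beta> \<bullet> w" and le: "w1 \<le> ?v"
    by auto
  have "(\<gamma> * w1, \<gamma> *\<^sub>R w) \<in> dual_feasible A b c c0 d d0 \<gamma>"
    using w scaleR_left_mono[OF col \<gamma>] mult_left_mono[OF shift \<gamma>] \<gamma>
    by (auto simp: dual_feasible_def matrix_vector_mult_scaleR scaleR_right_distrib algebra_simps
        simp del: transpose_matrix_vector intro: scaleR_nonneg_nonneg)
  then show ?thesis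
    using mult_left_mono[OF le \<gamma>] by (intro that) auto
qed

lemma dual_optimal_value:
  fixes b :: "'n::finite \<Rightarrow> real^'m"
  assumes opt: "primal_optimal A b c c0 d d0 UNIV z" and \<gamma>: "\<gamma> \<ge> 0"
    and \<omega>: "dual_optimal A b c c0 d d0 \<gamma> \<omega>"
  shows "fst \<omega> = \<gamma> * primal_value A b c c0 d d0 UNIV"
proof (rule antisym)
  obtain \<omega>' where "\<omega>' \<in> dual_feasible A b c c0 d d0 \<gamma>" "fst \<omega>' \<le> \<gamma> * primal_objective c c0 z"
    using strong_duality[OF opt \<gamma>] .
  then show "fst \<omega> \<le> \<gamma> * primal_value A b c c0 d d0 UNIV"
    using \<omega> unfolding primal_value_eq[OF opt] dual_optimal_def by force
  show "\<gamma> * primal_value A b c c0 d d0 UNIV \<le> fst \<omega>"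
    using weak_duality opt \<omega> unfolding primal_value_eq[OF opt] dual_optimal_def primal_optimal_def
    by blast
qed

lemma primal_value_mono:
  fixes b :: "'n::finite \<Rightarrow> real^'m"
  assumes b_nonneg: "\<And>i k. b i $ k \<ge> 0" and "S \<subseteq> S'"
    and opt: "primal_optimal A b c c0 d d0 S z" and opt': "primal_optimal A b c c0 d d0 S' z'"
  shows "primal_value A b c c0 d d0 S \<le> primal_value A b c c0 d d0 S'"
proof -
  have "sum b S \<le> sum b S'"
    using assms(1,2) by (intro sum_mono2) (auto simp: less_eq_vec_def)
  \<comment> \<open>The resource bound is multiplied by the variable \<open>t\<close>, so its sign
    decides whether a larger coalition has a larger feasible set.\<close>
  then have "t *\<^sub>R sum b S \<le> t *\<^sub>R sum b S'" if "t > 0" for t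
    using that by (intro scaleR_left_mono) auto
  then have "primal_feasible A b d d0 S \<subseteq> primal_feasible A b d d0 S'"
    unfolding primal_feasible_def by (auto intro: order_trans)
  then show ?thesis
    using opt opt' unfolding primal_value_eq[OF opt] primal_value_eq[OF opt'] primal_optimal_def
    by blast
qed

theorem mainTheorem2:
  fixes A :: "real^'p^'m"
    and b :: "'n::finite \<Rightarrow> real^'m"
    and c d :: "real^'p"
    and c0 d0 \<gamma> :: real
    and \<omega> :: "real \<times> (real^'m)"
    and u :: "real^'n"
  assumes b_nonneg: "\<And>i k. b i $ k \<ge> 0"
    and denominator_pos:
      "\<And>S x. S \<noteq> {} \<Longrightarrow> x \<in> production_set A b S \<Longrightarrow> d \<bullet> x + d0 > 0"
    and primal_solvable: "\<And>S. S \<noteq> {} \<Longrightarrow> \<exists>z. primal_optimal A b c c0 d d0 S z"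
    and gamma: "\<gamma> > max (max_balancing_total (UNIV :: 'n set)) (real CARD('n))"
    and omega: "dual_optimal A b c c0 d d0 \<gamma> \<omega>"
    and u: "\<And>i. u $ i = 1 / real CARD('n) * fst \<omega>"
  shows "u \<in> core (production_game A b c c0 d d0 \<gamma>)"
proof -
  let ?n = "real CARD('n)" and ?v = "primal_value A b c c0 d d0"
  have \<gamma>: "\<gamma> > ?n" using gamma by simp
  then have \<gamma>0: "\<gamma> > 0" by (smt (verit) of_nat_0_le_iff)
  obtain z where opt: "primal_optimal A b c c0 d d0 UNIV z"
    using primal_solvable by blast
  have \<omega>: "fst \<omega> = \<gamma> * ?v UNIV"
    using dual_optimal_value[OF opt _ omega] \<gamma>0 by simp
  have "fst \<omega> \<ge> 0"
    using omega unfolding dual_optimal_def dual_feasible_def by auto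
  then have v: "?v UNIV \<ge> 0"
    using \<omega> \<gamma>0 by (simp add: zero_le_mult_iff)
  have sum_u: "(\<Sum>i\<in>S. u $ i) = real (card S) * (fst \<omega> / ?n)" for S
    by (simp add: u)
  have "?v S \<le> (\<Sum>i\<in>S. u $ i)" if "S \<noteq> {}" for S
  proof -
    obtain z' where "primal_optimal A b c c0 d d0 S z'"
      using primal_solvable[OF \<open>S \<noteq> {}\<close>] by blast
    then have "?v S \<le> 1 * ?v UNIV"
      using primal_value_mono[OF b_nonneg subset_UNIV _ opt] by simp
    \<comment> \<open>Here \<gamma> / n > 1 is combined with \<open>v\<close>; for a negative value
      of P(N) the inequality would reverse.\<close>
    also have "\<dots> \<le> \<gamma> / ?n * ?v UNIV"
      using \<gamma> v by (intro mult_right_mono) auto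
    also have "\<dots> = 1 * (fst \<omega> / ?n)"
      using \<omega> by simp
    \<comment> \<open>A nonempty coalition receives at least one share, and shares are
      nonnegative.\<close>
    also have "\<dots> \<le> real (card S) * (fst \<omega> / ?n)"
      using that \<open>fst \<omega> \<ge> 0\<close> by (intro mult_right_mono) (auto simp: Suc_le_eq card_gt_0_iff)
    finally show ?thesis
      unfolding sum_u .
  qed
  moreover have "(\<Sum>i\<in>UNIV. u $ i) = \<gamma> * ?v UNIV"
    unfolding sum_u \<omega> by simp
  ultimately show ?thesis
    unfolding core_def production_game_def by auto
qed

end
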